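(* Let $(M,\omega)$ be an exact symplectic manifold of dimension $2n$ and let $U\subset M$ be a star-shaped open subset (in local coordinates). Let $S\in\mathbb{M}_{2n\times2n}(\mathbb{R})$ be symmetric, with $I_{2n}+2JS$ invertible, and consider the implicit map $$\rho(z,Z)=\left(\tfrac12 I_{2n}-JS\right)z+\left(\tfrac12 I_{2n}+JS\right)Z .$$ Then the consistency map $\psi=\psi_2^{-1}\circ\psi_1$ associated to $\rho$ is symplectic and it corresponds to the Cayley transformation of the matrix $2JS$; that is, with $\mathbf{H}=2JS$, the linearization of $\psi$ is $$T\psi=(I_{2n}+\mathbf{H})^{-1}(I_{2n}-\mathbf{H}).$$
   Context: One works in local coordinates on $U$ in which $\omega=\sum_{i,j}\tfrac12 J_{ij}\,dz_j\wedge dz_i$ with a constant real matrix $J=[J_{ij}]$ satisfying $J^T=-J$ and $J^2=-I_{2n}$. A linear map with matrix $P$ is symplectic if $P^TJP=J$. An implicit map is called consistent if there are two explicit maps $\psi_1,\psi_2$ and a point $\bar z$ such that $\bar z=\psi_1(z)$ and $\bar z=\psi_2(Z)$; the map $\psi=\psi_2^{-1}\circ\psi_1$, $z\mapsto Z$, is its consistency map. For the implicit map $\rho$ the explicit maps are the linear maps obtained by writing $\rho(z,Z)=\tfrac12\big(T\psi_1(z)+T\psi_2(Z)\big)$, that is, $T\psi_1(z)=(I_{2n}-2JS)z$ and $T\psi_2(Z)=(I_{2n}+2JS)Z$. A matrix $A$ is non-exceptional if $\det(I+A)\ne0$; the Cayley transformation of a non-exceptional matrix $\mathbf{H}$ is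 $(I-\mathbf{H})(I+\mathbf{H})^{-1}=(I+\mathbf{H})^{-1}(I-\mathbf{H})$. *)

theory Defs
  imports "HOL-Analysis.Analysis"
begin

text \<open>On an open set \<open>X\<close> of a finite-dimensional space this is the usual class \<open>C\<^sup>k\<close>: the iterated
  directional derivatives exist and are continuous.\<close>

primrec Ck_on :: "nat \<Rightarrow> 'a::euclidean_space set \<Rightarrow> ('a \<Rightarrow> 'b::real_normed_vector) \<Rightarrow> bool" where
  "Ck_on 0 X f \<longleftrightarrow> continuous_on X f"
| "Ck_on (Suc k) X f \<longleftrightarrow>
     (\<forall>x\<in>X. f differentiable (at x)) \<and> (\<forall>v. Ck_on k X (\<lambda>x. frechet_derivative f (at x) v))"

definition smooth_on :: "'a::euclidean_space set \<Rightarrow> ('a \<Rightarrow> 'b::real_normed_vector) \<Rightarrow> bool" where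
  "smooth_on X f \<longleftrightarrow> (\<forall>k. Ck_on k X f)"

text \<open>A chart is a pair of a domain and a coordinate map; the values of the coordinate map outside
  the domain are irrelevant.\<close>

type_synonym ('a, 'm) chart = "'a set \<times> ('a \<Rightarrow> real ^ 'm)"

definition is_chart :: "'a topology \<Rightarrow> ('a, 'm::finite) chart \<Rightarrow> bool" where
  "is_chart M c \<longleftrightarrow> openin M (fst c) \<and> open (snd c ` fst c) \<and>
     homeomorphic_map (subtopology M (fst c)) (top_of_set (snd c ` fst c)) (snd c)"

definition transition :: "('a, 'm::finite) chart \<Rightarrow> ('a, 'm) chart \<Rightarrow> real ^ 'm \<Rightarrow> real ^ 'm" where
  "transition c d = snd d \<circ> inv_into (fst c) (snd c)"

definition overlap :: "('a, 'm::finite) chart \<Rightarrow> ('a, 'm) chart \<Rightarrow> (real ^ 'm) set" where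
  "overlap c d = snd c ` (fst c \<inter> fst d)"

definition compatible_charts :: "('a, 'm::finite) chart \<Rightarrow> ('a, 'm) chart \<Rightarrow> bool" where
  "compatible_charts c d \<longleftrightarrow>
     smooth_on (overlap c d) (transition c d) \<and> smooth_on (overlap d c) (transition d c)"

text \<open>The set \<open>A\<close> of charts is a maximal smooth atlas; the dimension is \<open>CARD('m)\<close>.\<close>

definition smooth_manifold :: "'a topology \<Rightarrow> ('a, 'm::finite) chart set \<Rightarrow> bool" where
  "smooth_manifold M A \<longleftrightarrow>
     Hausdorff_space M \<and> second_countable M \<and>
     (\<forall>c\<in>A. is_chart M c) \<and> (\<Union>c\<in>A. fst c) = topspace M \<and>
     (\<forall>c\<in>A. \<forall>d\<in>A. compatible_charts c d) \<and>
     (\<forall>c. is_chart M c \<and> (\<forall>d\<in>A. compatible_charts c d) \<longrightarrow> c \<in> A)"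

text \<open>Differential forms are given by their local representatives in the charts, which
  transform into each other by pull-back along the transition maps.\<close>

type_synonym ('a, 'm) form1 = "('a, 'm) chart \<Rightarrow> real ^ 'm \<Rightarrow> real ^ 'm \<Rightarrow> real"
type_synonym ('a, 'm) form2 = "('a, 'm) chart \<Rightarrow> real ^ 'm \<Rightarrow> real ^ 'm \<Rightarrow> real ^ 'm \<Rightarrow> real"

definition is_form1 :: "('a, 'm::finite) chart set \<Rightarrow> ('a, 'm) form1 \<Rightarrow> bool" where
  "is_form1 A \<theta> \<longleftrightarrow>
     (\<forall>c\<in>A. (\<forall>x \<in> snd c ` fst c. linear (\<theta> c x)) \<and>
             (\<forall>u. smooth_on (snd c ` fst c) (\<lambda>x. \<theta> c x u))) \<and>
     (\<forall>c\<in>A. \<forall>d\<in>A. \<forall>x\<in>overlap c d. \<forall>u.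
        \<theta> c x u = \<theta> d (transition c d x) (frechet_derivative (transition c d) (at x) u))"

definition is_form2 :: "('a, 'm::finite) chart set \<Rightarrow> ('a, 'm) form2 \<Rightarrow> bool" where
  "is_form2 A \<omega> \<longleftrightarrow>
     (\<forall>c\<in>A. (\<forall>x \<in> snd c ` fst c. bilinear (\<omega> c x) \<and> (\<forall>u. \<omega> c x u u = 0)) \<and>
             (\<forall>u v. smooth_on (snd c ` fst c) (\<lambda>x. \<omega> c x u v))) \<and>
     (\<forall>c\<in>A. \<forall>d\<in>A. \<forall>x\<in>overlap c d. \<forall>u v.
        \<omega> c x u v = \<omega> d (transition c d x)
          (frechet_derivative (transition c d) (at x) u)
          (frechet_derivative (transition c d) (at x) v))"

definition ext_deriv1 :: "('a, 'm::finite) form1 \<Rightarrow> ('a, 'm) form2" where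
  "ext_deriv1 \<theta> c x u v =
     frechet_derivative (\<lambda>y. \<theta> c y v) (at x) u - frechet_derivative (\<lambda>y. \<theta> c y u) (at x) v"

definition ext_deriv2 ::
  "('a, 'm::finite) form2 \<Rightarrow> ('a, 'm) chart \<Rightarrow> real ^ 'm \<Rightarrow> real ^ 'm \<Rightarrow> real ^ 'm \<Rightarrow> real ^ 'm \<Rightarrow> real" where
  "ext_deriv2 \<omega> c x u v w =
     frechet_derivative (\<lambda>y. \<omega> c y v w) (at x) u
     - frechet_derivative (\<lambda>y. \<omega> c y u w) (at x) v
     + frechet_derivative (\<lambda>y. \<omega> c y u v) (at x) w"

definition symplectic_form :: "('a, 'm::finite) chart set \<Rightarrow> ('a, 'm) form2 \<Rightarrow> bool" where
  "symplectic_form A \<omega> \<longleftrightarrow> is_form2 A \<omega> \<and>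
     (\<forall>c\<in>A. \<forall>x \<in> snd c ` fst c.
        (\<forall>u v w. ext_deriv2 \<omega> c x u v w = 0) \<and> (\<forall>u. (\<forall>v. \<omega> c x u v = 0) \<longrightarrow> u = 0))"

definition exact_form2 :: "('a, 'm::finite) chart set \<Rightarrow> ('a, 'm) form2 \<Rightarrow> bool" where
  "exact_form2 A \<omega> \<longleftrightarrow>
     (\<exists>\<theta>. is_form1 A \<theta> \<and> (\<forall>c\<in>A. \<forall>x \<in> snd c ` fst c. \<forall>u v. \<omega> c x u v = ext_deriv1 \<theta> c x u v))"

definition exact_symplectic_manifold ::
  "'a topology \<Rightarrow> ('a, 'm::finite) chart set \<Rightarrow> ('a, 'm) form2 \<Rightarrow> bool" where
  "exact_symplectic_manifold M A \<omega> \<longleftrightarrow>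
     smooth_manifold M A \<and> symplectic_form A \<omega> \<and> exact_form2 A \<omega>"

text \<open>The constant 2-form \<open>\<Sum>i j. 1/2 J\<^sub>i\<^sub>j dz\<^sub>j \<and> dz\<^sub>i\<close>, where
  \<open>(dz\<^sub>j \<and> dz\<^sub>i)(u, v) = u\<^sub>j v\<^sub>i - u\<^sub>i v\<^sub>j\<close>.\<close>

definition const_form2 :: "real ^ 'm ^ 'm \<Rightarrow> real ^ 'm::finite \<Rightarrow> real ^ 'm \<Rightarrow> real" where
  "const_form2 J u v = (\<Sum>i\<in>UNIV. \<Sum>j\<in>UNIV. 1/2 * J $ i $ j * (u $ j * v $ i - u $ i * v $ j))"

definition symplectic_map :: "real ^ 'm ^ 'm \<Rightarrow> (real ^ 'm::finite \<Rightarrow> real ^ 'm) \<Rightarrow> bool" where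
  "symplectic_map J f \<longleftrightarrow> linear f \<and> transpose (matrix f) ** J ** matrix f = J"

definition implicit_map ::
  "real ^ 'm ^ 'm \<Rightarrow> real ^ 'm ^ 'm \<Rightarrow> real ^ 'm::finite \<Rightarrow> real ^ 'm \<Rightarrow> real ^ 'm" where
  "implicit_map J S z Z =
     ((1/2) *\<^sub>R mat 1 - J ** S) *v z + ((1/2) *\<^sub>R mat 1 + J ** S) *v Z"

text \<open>The two explicit maps are linear, so they coincide with their tangent maps.\<close>

definition explicit_map1 :: "real ^ 'm ^ 'm \<Rightarrow> real ^ 'm ^ 'm \<Rightarrow> real ^ 'm::finite \<Rightarrow> real ^ 'm" where
  "explicit_map1 J S z = (mat 1 - 2 *\<^sub>R (J ** S)) *v z"

definition explicit_map2 :: "real ^ 'm ^ 'm \<Rightarrow> real ^ 'm ^ 'm \<Rightarrow> real ^ 'm::finite \<Rightarrow> real ^ 'm" where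
  "explicit_map2 J S Z = (mat 1 + 2 *\<^sub>R (J ** S)) *v Z"

definition explicit_maps_of ::
  "(real ^ 'm::finite \<Rightarrow> real ^ 'm \<Rightarrow> real ^ 'm) \<Rightarrow>
   (real ^ 'm \<Rightarrow> real ^ 'm) \<Rightarrow> (real ^ 'm \<Rightarrow> real ^ 'm) \<Rightarrow> bool" where
  "explicit_maps_of \<rho> \<psi>1 \<psi>2 \<longleftrightarrow>
     linear \<psi>1 \<and> linear \<psi>2 \<and> (\<forall>z Z. \<rho> z Z = (1/2) *\<^sub>R (\<psi>1 z + \<psi>2 Z))"

definition consistent_at :: "('b \<Rightarrow> 'b) \<Rightarrow> ('b \<Rightarrow> 'b) \<Rightarrow> 'b \<Rightarrow> 'b \<Rightarrow> bool" where
  "consistent_at \<psi>1 \<psi>2 z Z \<longleftrightarrow> (\<exists>zbar. zbar = \<psi>1 z \<and> zbar = \<psi>2 Z)"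

text \<open>Meaningful only when \<open>\<psi>2\<close> is bijective.\<close>

definition consistency_map :: "('b \<Rightarrow> 'b) \<Rightarrow> ('b \<Rightarrow> 'b) \<Rightarrow> 'b \<Rightarrow> 'b" where
  "consistency_map \<psi>1 \<psi>2 = inv \<psi>2 \<circ> \<psi>1"

definition non_exceptional :: "real ^ 'm ^ 'm::finite \<Rightarrow> bool" where
  "non_exceptional A \<longleftrightarrow> det (mat 1 + A) \<noteq> 0"

definition cayley :: "real ^ 'm ^ 'm::finite \<Rightarrow> real ^ 'm ^ 'm" where
  "cayley H = (mat 1 - H) ** matrix_inv (mat 1 + H)"

end

theory Submission
  imports Defs
begin

text \<open>Since \<open>J\<close> is skew with \<open>J\<^sup>2 = - I\<close> and \<open>S\<close> is symmetric, \<open>H = 2JS\<close> is Hamiltonian: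
  \<open>H\<^sup>T J = 2S = - J H\<close>. Hence \<open>(I - H)\<^sup>T J = J (I + H)\<close> and vice versa, so \<open>J\<close> can be moved through the
  Cayley transform; writing the left factor as \<open>(I - H)(I + H)\<^sup>-\<^sup>1\<close> and the right one as
  \<open>(I + H)\<^sup>-\<^sup>1(I - H)\<close> makes the inverses cancel.\<close>

lemma matrix_add_rdistrib:
  fixes A B :: "'a::semiring_1 ^ 'n ^ 'm"
  shows "(A + B) ** C = A ** C + B ** C"
  by (simp add: matrix_matrix_mult_def vec_eq_iff sum.distrib distrib_right)

lemma matrix_sub_ldistrib:
  fixes A :: "'a::ring_1 ^ 'n ^ 'm"
  shows "A ** (B - C) = A ** B - A ** C"
  by (simp add: matrix_matrix_mult_def vec_eq_iff sum_subtractf right_diff_distrib)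

lemma matrix_sub_rdistrib:
  fixes A B :: "'a::ring_1 ^ 'n ^ 'm"
  shows "(A - B) ** C = A ** C - B ** C"
  by (simp add: matrix_matrix_mult_def vec_eq_iff sum_subtractf left_diff_distrib)

lemma matrix_minus_mult:
  fixes A :: "'a::ring_1 ^ 'n ^ 'm"
  shows "(- A) ** B = - (A ** B)" and "A ** (- B) = - (A ** B)"
  by (simp_all add: matrix_matrix_mult_def vec_eq_iff sum_negf)

text \<open>\<open>matrix_inv\<close> chooses some two-sided inverse, and invertibility supplies
  one, so the choice satisfies both equations.\<close>

lemma matrix_inv_inverse:
  fixes B :: "real ^ 'm ^ 'm::finite"
  assumes "invertible B"
  shows "B ** matrix_inv B = mat 1" and "matrix_inv B ** B = mat 1"
  using someI_ex[OF assms[unfolded invertible_def]] by (auto simp: matrix_inv_def)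

text \<open>Both \<open>mat 1 + H\<close> and \<open>mat 1 - H\<close> are polynomials in
  \<open>H\<close>, so they commute, and a matrix commuting with an invertible one commutes with its
  inverse.\<close>

lemma cayley_commute:
  fixes H :: "real ^ 'm ^ 'm::finite"
  assumes "invertible (mat 1 + H)"
  shows "cayley H = matrix_inv (mat 1 + H) ** (mat 1 - H)"
proof -
  let ?B = "mat 1 + H" and ?C = "mat 1 - H"
  have BC: "?B ** ?C = ?C ** ?B"
    by (simp add: vec_eq_iff matrix_add_ldistrib matrix_add_rdistrib
        matrix_sub_ldistrib matrix_sub_rdistrib)
  \<comment> \<open>Inserting the identity as \<open>matrix_inv ?B ** ?B\<close> on the left creates
    the product \<open>?B ** ?C\<close> to be swapped.\<close>
  have "?C ** matrix_inv ?B = matrix_inv ?B ** (?B ** ?C) ** matrix_inv ?B"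
    by (simp add: matrix_mul_assoc matrix_inv_inverse[OF assms])
  also have "\<dots> = matrix_inv ?B ** ?C ** (?B ** matrix_inv ?B)"
    by (simp add: BC matrix_mul_assoc)
  also have "\<dots> = matrix_inv ?B ** ?C"
    by (simp add: matrix_inv_inverse[OF assms])
  finally show ?thesis
    by (simp add: cayley_def)
qed

text \<open>The condition \<open>skew\<close> puts \<open>H\<close> in the Lie algebra of the group
  preserving the bilinear form of \<open>J\<close>; the Cayley transform carries it into that
  group.\<close>

lemma cayley_preserves_form:
  fixes H J :: "real ^ 'm ^ 'm::finite"
  assumes inv: "invertible (mat 1 + H)" and skew: "transpose H ** J = - (J ** H)"
  shows "transpose (cayley H) ** J ** cayley H = J"
proof -
  let ?B = "mat 1 + H" and ?C = "mat 1 - H"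
  have tr: "transpose ?B = mat 1 + transpose H" "transpose ?C = mat 1 - transpose H"
    by (auto simp: transpose_def vec_eq_iff mat_def)
  have CJ: "transpose ?C ** J = J ** ?B"
    by (simp add: tr matrix_sub_rdistrib matrix_add_ldistrib skew)
  have BJ: "transpose ?B ** J = J ** ?C"
    by (simp add: tr matrix_add_rdistrib matrix_sub_ldistrib skew)
  have "transpose (cayley H) ** J ** cayley H
      = transpose (matrix_inv ?B) ** (transpose ?C ** J) ** cayley H"
    by (simp add: cayley_def matrix_transpose_mul matrix_mul_assoc)
  also have "\<dots> = transpose (matrix_inv ?B) ** J ** (?B ** matrix_inv ?B) ** ?C"
    by (simp add: CJ cayley_commute[OF inv] matrix_mul_assoc)
  \<comment> \<open>With the right inverse gone, \<open>BJ\<close> is read backwards: the remaining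
    \<open>J ** ?C\<close> becomes \<open>transpose ?B ** J\<close>, which meets the transposed
    inverse.\<close>
  also have "\<dots> = transpose (matrix_inv ?B) ** (transpose ?B ** J)"
    by (simp add: matrix_inv_inverse[OF inv] BJ matrix_mul_assoc)
  also have "\<dots> = transpose (?B ** matrix_inv ?B) ** J"
    by (simp add: matrix_transpose_mul matrix_mul_assoc)
  finally show ?thesis
    by (simp add: matrix_inv_inverse[OF inv])
qed

text \<open>Up to scale and sign, \<open>J ** S\<close> generates the linear flow of the quadratic
  Hamiltonian with Hessian \<open>S\<close>. Both sides reduce to
  \<open>2 *\<^sub>R S\<close>.\<close>

lemma linear_hamiltonian_skew:
  fixes J S :: "real ^ 'm ^ 'm::finite"
  assumes "transpose J = - J" and "transpose S = S" and "J ** J = - mat 1"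
  shows "transpose (2 *\<^sub>R (J ** S)) ** J = - (J ** (2 *\<^sub>R (J ** S)))"
proof -
  have "transpose (2 *\<^sub>R (J ** S)) ** J = 2 *\<^sub>R ((S ** - J) ** J)"
    by (simp add: transpose_scalar matrix_transpose_mul assms(1,2) scalar_matrix_assoc[symmetric])
  also have "\<dots> = 2 *\<^sub>R S"
    by (simp add: matrix_minus_mult assms(3) matrix_mul_assoc[symmetric])
  also have "\<dots> = - (J ** (2 *\<^sub>R (J ** S)))"
    by (simp add: matrix_scalar_ac scalar_matrix_assoc[symmetric] matrix_mul_assoc assms(3)
        matrix_minus_mult)
  finally show ?thesis .
qed

theorem proposition2:
  fixes M :: "'a topology"
    and A :: "('a, 'm::finite) chart set"
    and \<omega> :: "('a, 'm) form2"
    and n :: nat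
    and U :: "'a set"
    and \<phi> :: "'a \<Rightarrow> real ^ 'm"
    and J S H :: "real ^ 'm ^ 'm"
    and \<psi>1 \<psi>2 \<psi> :: "real ^ 'm \<Rightarrow> real ^ 'm"
  assumes "exact_symplectic_manifold M A \<omega>"
    and "CARD('m) = 2 * n"
    and "(U, \<phi>) \<in> A"
    and "starlike (\<phi> ` U)"
    and "transpose J = - J"
    and "J ** J = - mat 1"
    and "\<forall>x \<in> \<phi> ` U. \<forall>u v. \<omega> (U, \<phi>) x u v = const_form2 J u v"
    and "transpose S = S"
    and "invertible (mat 1 + 2 *\<^sub>R (J ** S))"
    and "\<psi>1 = explicit_map1 J S"
    and "\<psi>2 = explicit_map2 J S"
    and "\<psi> = consistency_map \<psi>1 \<psi>2"
    and "H = 2 *\<^sub>R (J ** S)"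
  shows "explicit_maps_of (implicit_map J S) \<psi>1 \<psi>2 \<and>
    bij \<psi>2 \<and>
    (\<forall>z Z. consistent_at \<psi>1 \<psi>2 z Z \<longleftrightarrow> Z = \<psi> z) \<and>
    symplectic_map J \<psi> \<and>
    non_exceptional H \<and>
    (\<forall>z. (\<psi> has_derivative (\<lambda>h. cayley H *v h)) (at z)) \<and>
    cayley H = matrix_inv (mat 1 + H) ** (mat 1 - H)"
proof -
  note maps = assms(10-12) and H = assms(13)
  let ?B = "mat 1 + H" and ?C = "mat 1 - H"
  have inv: "invertible ?B"
    using assms(9) H by simp
  note B = matrix_inv_inverse[OF inv]
  have \<psi>1: "\<psi>1 = (*v) ?C" and \<psi>2: "\<psi>2 = (*v) ?B"
    by (auto simp: maps H explicit_map1_def explicit_map2_def)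
  have left: "matrix_inv ?B *v (?B *v x) = x" and right: "?B *v (matrix_inv ?B *v x) = x" for x
    by (simp_all add: matrix_vector_mul_assoc B)
  have bij: "bij \<psi>2"
    unfolding \<psi>2 by (rule bij_betw_byWitness[where f' = "(*v) (matrix_inv ?B)"])
      (auto simp: left right)
  have "inv \<psi>2 = (*v) (matrix_inv ?B)"
    unfolding \<psi>2 by (rule inv_equality) (simp_all only: left right)
  \<comment> \<open>Composing the maps puts the inverse on the left, whereas \<open>cayley\<close>
    has it on the right; \<open>cayley_commute\<close> reconciles the two.\<close>
  then have \<psi>: "\<psi> = (*v) (cayley H)"
    by (auto simp: maps(3) consistency_map_def \<psi>1 cayley_commute[OF inv] matrix_vector_mul_assoc)
  have "implicit_map J S z Z = (1/2) *\<^sub>R (\<psi>1 z + \<psi>2 Z)" for z Z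
  proof -
    have "(1/2) *\<^sub>R mat 1 - J ** S = (1/2) *\<^sub>R ?C" "(1/2) *\<^sub>R mat 1 + J ** S = (1/2) *\<^sub>R ?B"
      by (simp_all add: H scaleR_diff_right scaleR_add_right)
    then show ?thesis
      by (simp add: implicit_map_def \<psi>1 \<psi>2 scaleR_add_right scaleR_matrix_vector_assoc)
  qed
  then have "explicit_maps_of (implicit_map J S) \<psi>1 \<psi>2"
    by (simp add: explicit_maps_of_def \<psi>1 \<psi>2)
  \<comment> \<open>The intermediate point \<open>zbar\<close> exists exactly when
    \<open>\<psi>1 z = \<psi>2 Z\<close>, which bijectivity of \<open>\<psi>2\<close> solves
    uniquely for \<open>Z\<close>.\<close>
  moreover have "consistent_at \<psi>1 \<psi>2 z Z \<longleftrightarrow> Z = \<psi> z" for z Z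
    using bij by (auto simp: consistent_at_def maps(3) consistency_map_def bij_inv_eq_iff)
  moreover have "symplectic_map J \<psi>"
    using cayley_preserves_form[OF inv] linear_hamiltonian_skew[OF assms(5,8,6)] H
    by (simp add: symplectic_map_def \<psi>)
  moreover have "non_exceptional H"
    using inv by (simp add: non_exceptional_def invertible_det_nz)
  \<comment> \<open>A linear map is its own derivative at every point.\<close>
  moreover have "(\<psi> has_derivative (\<lambda>h. cayley H *v h)) (at z)" for z
    unfolding \<psi> by (intro linear_imp_has_derivative) simp
  ultimately show ?thesis
    using bij cayley_commute[OF inv] by blast
qed

end
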